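(* Let $a\in(1/15,\infty)$ and let $F_a(x)=\psi(x+1)-\mathcal{L}(x,a)$ for $x\in(0,\infty)$. Then $F_a$ is convex on $(0,\infty)$ if and only if $a\in(1/15,a_0'']$, where $a_0''\approx 0.4321803644583305$ is the unique root on $(1/15,\infty)$ of the equation (in $a$) $$\psi''(1)-\mathcal{L}_{xx}(0,a)=0.$$
   Context: $\psi(x)=\Gamma'(x)/\Gamma(x)$ ($x>0$) is the digamma (psi) function. For $x\ge 0$ and $a>1/15$, $$\mathcal{L}(x,a)=\frac{1}{90a^{2}+2}\ln\left(x^{2}+x+\frac{3a+1}{3}\right)+\frac{45a^{2}}{90a^{2}+2}\ln\left(x^{2}+x+\frac{15a-1}{45a}\right),$$ and $\mathcal{L}_{xx}=\partial^2\mathcal{L}/\partial x^2$, that is, $$\mathcal{L}_{xx}(x,a)=-\frac{1}{45a^{2}+1}\,\frac{x^{2}+x-a+1/6}{\left(x^{2}+x+a+1/3\right)^{2}}-\frac{45a^{2}}{45a^{2}+1}\,\frac{x^{2}+x+1/(45a)+1/6}{\left(x^{2}+x+(15a-1)/(45a)\right)^{2}}.$$ *)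

theory Defs
  imports "HOL-Analysis.Analysis"
begin

lemma Digamma_eq_deriv_Gamma:
  fixes x :: real
  assumes "x > 0"
  shows "Digamma x = deriv Gamma x / Gamma x"
proof -
  have "(Gamma has_field_derivative Gamma x * Digamma x) (at x)"
    using assms by (intro has_field_derivative_Gamma) auto
  moreover have "Gamma x \<noteq> 0"
    using assms by (simp add: Gamma_real_pos less_imp_neq[symmetric])
  ultimately show ?thesis
    by (simp add: DERIV_imp_deriv)
qed

definition L :: "real \<Rightarrow> real \<Rightarrow> real" where
  "L x a = 1 / (90 * a^2 + 2) * ln (x^2 + x + (3 * a + 1) / 3)
         + 45 * a^2 / (90 * a^2 + 2) * ln (x^2 + x + (15 * a - 1) / (45 * a))"

text \<open>
  For \<open>a > 1/15\<close> both logarithms have positive arguments in a neighbourhood of every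
  \<open>x \<ge> 0\<close>, so at \<open>x = 0\<close> the two-sided derivative agrees with the one-sided one.
\<close>

definition Lxx :: "real \<Rightarrow> real \<Rightarrow> real" where
  "Lxx x a = (deriv ^^ 2) (\<lambda>t. L t a) x"

definition F :: "real \<Rightarrow> real \<Rightarrow> real" where
  "F a x = Digamma (x + 1) - L x a"

lemma Lxx_explicit:
  assumes "x \<ge> 0" "a > 1/15"
  shows "Lxx x a =
     - 1 / (45 * a^2 + 1) * ((x^2 + x - a + 1/6) / (x^2 + x + a + 1/3)^2)
     - 45 * a^2 / (45 * a^2 + 1)
         * ((x^2 + x + 1 / (45 * a) + 1/6) / (x^2 + x + (15 * a - 1) / (45 * a))^2)"
proof -
  define p where "p = (3 * a + 1) / 3"
  define q where "q = (15 * a - 1) / (45 * a)"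
  define k where "k = 1 / (90 * a^2 + 2)"
  define l where "l = 45 * a^2 / (90 * a^2 + 2)"
  define S where "S = {t::real. t^2 + t + p > 0} \<inter> {t. t^2 + t + q > 0}"
  have a: "a > 0" using assms by simp
  have pq: "p > 0" "q > 0" using assms by (auto simp: p_def q_def)
  have "open S" unfolding S_def
    by (intro open_Int open_Collect_less continuous_intros)
  have xS: "x \<in> S" using assms pq by (auto simp: S_def add_nonneg_pos)
  have D1: "deriv (\<lambda>t. L t a) t = k * ((2*t+1) / (t^2+t+p)) + l * ((2*t+1) / (t^2+t+q))"
    if "t \<in> S" for t
    unfolding L_def p_def[symmetric] q_def[symmetric] k_def[symmetric] l_def[symmetric]
    by (rule DERIV_imp_deriv) (use that in \<open>auto simp: S_def mult.commute intro!: derivative_eq_intros\<close>)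
  have "\<forall>\<^sub>F t in nhds x. deriv (\<lambda>t. L t a) t =
        k * ((2*t+1) / (t^2+t+p)) + l * ((2*t+1) / (t^2+t+q))"
    using \<open>open S\<close> xS D1 by (auto simp: eventually_nhds intro!: exI[of _ S])
  hence "Lxx x a = deriv (\<lambda>t. k * ((2*t+1) / (t^2+t+p)) + l * ((2*t+1) / (t^2+t+q))) x"
    by (simp add: Lxx_def eval_nat_numeral deriv_cong_ev)
  also have "\<dots> = k * ((2 * (x^2+x+p) - (2*x+1)^2) / (x^2+x+p)^2)
               + l * ((2 * (x^2+x+q) - (2*x+1)^2) / (x^2+x+q)^2)"
    by (rule DERIV_imp_deriv)
       (use xS in \<open>auto simp: S_def power2_eq_square algebra_simps intro!: derivative_eq_intros\<close>)
  also have "2 * (x^2+x+p) - (2*x+1)^2 = -2 * (x^2 + x - a + 1/6)"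
    by (simp add: p_def power2_eq_square algebra_simps)
  also have "2 * (x^2+x+q) - (2*x+1)^2 = -2 * (x^2 + x + 1 / (45 * a) + 1/6)"
    using a by (simp add: q_def power2_eq_square field_simps)
  also have "x^2 + x + p = x^2 + x + a + 1/3" by (simp add: p_def field_simps)
  also have "k = 1 / (45 * a^2 + 1) / 2" by (simp add: k_def field_simps)
  also have "l = 45 * a^2 / (45 * a^2 + 1) / 2" by (simp add: l_def)
  finally have fin: "Lxx x a =
      1 / (45 * a^2 + 1) / 2 * (-2 * (x^2 + x - a + 1/6) / (x^2 + x + a + 1/3)^2)
    + 45 * a^2 / (45 * a^2 + 1) / 2
        * (-2 * (x^2 + x + 1 / (45 * a) + 1/6) / (x^2 + x + q)^2)" .
  have half: "K / 2 * (-2 * M / P) + K' / 2 * (-2 * N / Q) = - K * (M / P) - K' * (N / Q)"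
    for K K' M N P Q :: real
    by simp
  show ?thesis unfolding fin half q_def by simp
qed

end

theory Submission
  imports Defs "HOL-Real_Asymp.Real_Asymp"
begin

text \<open>
  Write \<open>K(a, u)\<close> for minus \<open>Lxx\<close> with \<open>u = x\<^sup>2 + x\<close>, so that the second derivative of
  \<open>F a\<close> is \<open>\<psi>''(x + 1) + K(a, x\<^sup>2 + x)\<close>, which also makes sense at \<open>x = 0\<close>.
  The theorem says that the sign of this function on \<open>x > 0\<close> is governed by its value
  at \<open>x = 0\<close>.  Two facts are behind it.

  \<^item> \<^emph>\<open>\<open>K\<close> strictly decreases in \<open>a\<close>\<close> (\<open>neg_Lxx_strict_antimono\<close>).  With \<open>b = 1/(45a)\<close> and
    \<open>M = u + 1/3\<close>, \<open>K\<close> is an average over the two nodes \<open>a\<close> and \<open>-b\<close> with weights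
    \<open>b/(a+b)\<close> and \<open>a/(a+b)\<close>.  These nodes have mean \<open>0\<close> and variance \<open>ab = 1/45\<close> whatever \<open>a\<close> is,
    so only the skewness, measured by \<open>a - b\<close>, varies, and \<open>K\<close> becomes a polynomial in
    \<open>t = 1/(M(M + a - b) - 1/45)\<close> with positive coefficients (\<open>neg_Lxx_expansion\<close>).
    At \<open>u = 0\<close> this gives the uniqueness of the root \<open>a0\<close>, and for every \<open>x\<close> it reduces convexity
    for \<open>a \<le> a0\<close> to convexity for \<open>a = a0\<close>.
    Conversely, convexity of \<open>F a\<close> forces the second derivative to be nonnegative at \<open>0\<close>
    by continuity, hence \<open>a \<le> a0\<close>.

  \<^item> \<^emph>\<open>For \<open>a = a0\<close> the second derivative is positive on \<open>x > 0\<close>\<close>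
    (\<open>Polygamma_2_plus_neg_Lxx_pos\<close>).  It vanishes at \<open>0\<close>, so a lower bound with room to spare
    exists only away from \<open>0\<close>.  For \<open>x \<ge> 1/20\<close> it dominates its value for the rational parameter
    \<open>4/9 > a0\<close>, and that value is nonnegative by telescoping:
    \<open>-\<psi>''(y) = \<Sum>2/(y+n)\<^sup>3\<close>, and \<open>2/y\<^sup>3\<close> is at most the decrement of \<open>K(4/9, x\<^sup>2 + x)\<close> from \<open>x = y - 1\<close>
    to \<open>x = y\<close>.  For \<open>x \<le> 1/20\<close> the function increases from its value \<open>0\<close> at \<open>0\<close>.

  The digits of \<open>a0\<close> come from the intermediate value theorem between two rational parameters.
  This needs \<open>-\<psi>''(1) = 2\<zeta>(3)\<close> to about 16 digits, obtained from 23 terms of the series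
  and an asymptotic estimate of the tail, justified by the same telescoping principle.
\<close>

section \<open>Minus the second derivative of L as a two-point average\<close>

definition neg_Lxx :: "real \<Rightarrow> real \<Rightarrow> real" where
  "neg_Lxx a u = 1 / (45 * a^2 + 1) * ((u - a + 1/6) / (u + a + 1/3)^2)
     + 45 * a^2 / (45 * a^2 + 1) * ((u + 1 / (45 * a) + 1/6) / (u + (15 * a - 1) / (45 * a))^2)"

lemma Lxx_eq: "x \<ge> 0 \<Longrightarrow> a > 1/15 \<Longrightarrow> Lxx x a = - neg_Lxx a (x^2 + x)"
  by (simp add: Lxx_explicit neg_Lxx_def algebra_simps)

lemma neg_Lxx_two_point:
  assumes "a > 0" "a * b = 1/45"
  shows "neg_Lxx a u = (b * ((u + 1/6 - a) / (u + 1/3 + a)^2) + a * ((u + 1/6 + b) / (u + 1/3 - b)^2)) / (a + b)"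
proof -
  have b: "b = 1 / (45 * a)" using assms by (simp add: field_simps)
  have "b > 0" using assms by (simp add: b)
  have 1: "1 / (45 * a^2 + 1) = b / (a + b)" "45 * a^2 / (45 * a^2 + 1) = a / (a + b)"
    using assms(1) by (simp_all add: b field_simps power2_eq_square add_pos_pos)
  have 2: "u + (15 * a - 1) / (45 * a) = u + 1/3 - b"
    using assms(1) by (simp add: b field_simps)
  show ?thesis
    unfolding neg_Lxx_def 1 2 b[symmetric]
    by (simp add: add_divide_distrib add_ac diff_add_eq[symmetric])
qed

text \<open>
  For a distribution on nodes \<open>a\<close>, \<open>-b\<close> with mean \<open>0\<close> and variance \<open>ab = k\<close> the average of
  \<open>1/(M + node)\<close> is \<open>e/(Me - k)\<close> with \<open>e = M + a - b\<close>.  Since \<open>neg_Lxx\<close> is a combination of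
  this average and its \<open>M\<close>-derivative, it depends on \<open>a\<close> only through \<open>e\<close>.
  Eliminating \<open>e\<close> in favour of \<open>t = 1/(Me - k)\<close> makes all coefficients positive, which
  turns monotonicity in \<open>a\<close> into monotonicity of \<open>t\<close>.
\<close>

lemma neg_Lxx_expansion:
  fixes a u :: real
  defines "M \<equiv> u + 1/3" and "A \<equiv> u + 1/6" and "k \<equiv> 1/45"
  defines "t \<equiv> 1 / (M * (M + a - 1 / (45 * a)) - k)"
  assumes "a > 1/15" "u \<ge> 0"
  shows "neg_Lxx a u = (A + t * (2 * A * k + k * M) + t^2 * (A * k^2 + k^2 * M + k * (2*u+1/2) * M^2)) / M^2"
proof -
  define b where "b = 1 / (45 * a)"
  define p where "p = M + a"
  define q where "q = M - b"
  have a: "a > 0" using assms by simp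
  have ab: "a * b = k" and b: "b > 0" "b < 1/3" using assms by (auto simp: b_def k_def field_simps)
  have pos: "p > 0" "q > 0" "M > 0" using assms a b by (auto simp: p_def q_def M_def)
  define e where "e = M + a - b"
  have pq: "p * q = M * e - k"
    unfolding ab[symmetric] p_def q_def e_def by (simp add: algebra_simps)
  have t: "t = 1 / (p * q)" unfolding pq by (simp add: t_def e_def b_def)
  have A: "A = M - 1/6" "2*u + 1/2 = 2 * M - 1/6" by (auto simp: A_def M_def)
  define B where "B = k * (2*u+1/2)"
  have e: "e = (k + p * q) / M" using pq pos by (simp add: field_simps)
  have num: "b * (A - a) * q^2 + a * (A + b) * p^2 = (a + b) * (A * e^2 + k * e + B)"
    unfolding B_def A ab[symmetric] p_def q_def e_def by algebra
  have "neg_Lxx a u = (b * ((A - a) / p^2) + a * ((A + b) / q^2)) / (a + b)"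
    using neg_Lxx_two_point[of a b u] a ab by (simp add: p_def q_def A_def M_def k_def)
  also have "\<dots> = (b * (A - a) * q^2 + a * (A + b) * p^2) / ((a + b) * (p^2 * q^2))"
    using pos by (simp add: field_simps)
  also have "\<dots> = (A * e^2 + k * e + B) / (p * q)^2"
    unfolding num using a b by (simp add: power_mult_distrib)
  also have "\<dots> = (A + t * (2 * A * k + k * M) + t^2 * (A * k^2 + k^2 * M + B * M^2)) / M^2"
  proof -
    define r where "r = p * q"
    have "r > 0" using pos by (simp add: r_def)
    have "(A * e^2 + k * e + B) * M^2 = A * (k + r)^2 + k * (k + r) * M + B * M^2"
      using pos unfolding e r_def[symmetric] by (simp add: field_simps power2_eq_square)
    hence "A * e^2 + k * e + B = (A * (k + r)^2 + k * (k + r) * M + B * M^2) / M^2"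
      using pos by (simp add: field_simps)
    moreover have "A + t * (2 * A * k + k * M) + t^2 * (A * k^2 + k^2 * M + B * M^2)
        = (A * (k + r)^2 + k * (k + r) * M + B * M^2) / r^2"
      using \<open>r > 0\<close> unfolding t r_def[symmetric] by (simp add: field_simps power2_eq_square)
    ultimately show ?thesis by (simp add: r_def mult.commute)
  qed
  finally show ?thesis by (simp add: B_def)
qed

lemma neg_Lxx_strict_antimono:
  assumes "1/15 < a" "a < a'" "u \<ge> 0"
  shows "neg_Lxx a' u < neg_Lxx a u"
proof -
  define M where "M = u + 1/3"
  define d where "d = (\<lambda>a::real. M * (M + a - 1 / (45 * a)) - 1/45)"
  have M: "M \<ge> 1/3" using assms by (simp add: M_def)
  have inv: "1 / (45 * a') < 1 / (45 * a)" "1 / (45 * a) < 1/3"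
    using assms by (auto simp: field_simps)
  have "1/3 * (1/15) \<le> M * (1/15)" using M by simp
  also have "\<dots> < M * (M + a - 1 / (45 * a))"
  proof (rule mult_strict_left_mono)
    show "1/15 < M + a - 1 / (45 * a)" using M inv assms by linarith
  qed (use M in auto)
  finally have d0: "0 < d a" by (simp add: d_def)
  have d1: "d a < d a'"
    unfolding d_def using M inv assms by (intro diff_strict_right_mono mult_strict_left_mono) auto
  define t where "t = 1 / d a"
  define t' where "t' = 1 / d a'"
  have t: "0 < t'" "t' < t" using d0 d1 by (auto simp: t_def t'_def field_simps)
  have "t'^2 < t^2" using t by (simp add: power_strict_mono)
  have "neg_Lxx a' u = ((u+1/6) + t' * (2 * (u+1/6) * (1/45) + 1/45 * M) + t'^2 * ((u+1/6) * (1/45)^2 + (1/45)^2 * M + 1/45 * (2*u+1/2) * M^2)) / M^2"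
    using neg_Lxx_expansion[of a' u] assms by (simp add: t'_def d_def M_def)
  also have "\<dots> < ((u+1/6) + t * (2 * (u+1/6) * (1/45) + 1/45 * M) + t^2 * ((u+1/6) * (1/45)^2 + (1/45)^2 * M + 1/45 * (2*u+1/2) * M^2)) / M^2"
    using t \<open>t'^2 < t^2\<close> M assms(3)
    by (intro divide_strict_right_mono add_strict_mono add_le_less_mono mult_strict_right_mono) (auto intro!: add_pos_nonneg add_nonneg_pos mult_pos_pos)
  also have "\<dots> = neg_Lxx a u"
    using neg_Lxx_expansion[of a u] assms by (simp add: t_def d_def M_def)
  finally show ?thesis .
qed

section \<open>Bounding polygamma series by telescoping\<close>

lemma sums_le_telescope:
  fixes f Q :: "nat \<Rightarrow> real"
  assumes "f sums s" "Q \<longlonglongrightarrow> 0" "\<And>n. f n \<le> Q n - Q (Suc n)"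
  shows "s \<le> Q 0"
  using sums_le[OF assms(3,1) telescope_sums'[OF assms(2)]] by simp

lemma telescope_le_sums:
  fixes f Q :: "nat \<Rightarrow> real"
  assumes "f sums s" "Q \<longlonglongrightarrow> 0" "\<And>n. Q n - Q (Suc n) \<le> f n"
  shows "Q 0 \<le> s"
  using sums_le[OF assms(3) telescope_sums'[OF assms(2)] assms(1)] by simp

lemma Polygamma_2_sums: "y > 0 \<Longrightarrow> (\<lambda>n. 2 / (y + real n)^3) sums (- Polygamma 2 y)"
  using sums_mult[OF Polygamma_LIMSEQ[of y 2], of 2] by (simp add: field_simps eval_nat_numeral)

lemma Polygamma_3_sums: "y > 0 \<Longrightarrow> (\<lambda>n. 6 / (y + real n)^4) sums Polygamma 3 y"
  using sums_mult[OF Polygamma_LIMSEQ[of y 3], of 6] by (simp add: field_simps eval_nat_numeral)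

section \<open>Numerical bounds for the series of zeta at 3\<close>

text \<open>
  The asymptotic expansion of \<open>-\<psi>''(z + 1/2)\<close>, which contains only even powers of \<open>1/z\<close>, up
  to order 8.  The true next coefficient is \<open>381/1280 = 0.2976...\<close>; replacing it by a
  slightly larger or smaller \<open>c\<close> gives upper and lower bounds.
\<close>

definition asymp_tail :: "real \<Rightarrow> real \<Rightarrow> real" where
  "asymp_tail c z = 1/z^2 - 1/4 * (1/z^4) + 7/48 * (1/z^6) - 31/192 * (1/z^8) + c * (1/z^10)"

text \<open>
  In the variable \<open>W = (y - 1/2)(y + 1/2)\<close> the powers of \<open>W\<close> above the sixth cancel in the
  numerator, because the coefficients are those of the asymptotic expansion.  The leading coefficient
  that remains is a positive multiple of \<open>c - 381/1280\<close>, so its sign decides for large \<open>y\<close>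
  which way the inequality goes.
\<close>

lemma asymp_tail_diff:
  fixes y c :: real
  defines "W \<equiv> y^2 - 1/4"
  assumes "y > 1/2"
  shows "asymp_tail c (y - 1/2) - asymp_tail c (y + 1/2) - 2 / y^3 =
    2 * (1/16 * c + c * W + (101/16 * c - 31/3072) * W^2 + (79/4 * c - 217/1536) * W^3 + (501/16 * c - 1133/1536) * W^4 + (45/2 * c - 437/256) * W^5 + (5 * c - 381/256) * W^6) / (y^3 * W^10)"
proof -
  define p where "p = y - 1/2"
  define s where "s = y + 1/2"
  define V where "V = 2 * W + 1"
  have pos: "p > 0" "s > 0" "y > 0" using assms by (auto simp: p_def s_def)
  have W: "W = p * s" and V: "V = p^2 + s^2" and y: "2 * y = p + s" and d: "s - p = 1"
    by (simp_all add: W_def V_def p_def s_def power2_eq_square algebra_simps)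
  have "W > 0" unfolding W using pos by simp
  have D: "1 / p^k - 1 / s^k = (s^k - p^k) / W^k" for k
    using pos unfolding W by (simp add: field_simps)
  have n1: "s^2 - p^2 = 2 * y" unfolding y using d by algebra
  have n2: "s^4 - p^4 = 2 * y * V" unfolding y V using d by algebra
  have n3: "s^6 - p^6 = 2 * y * (V^2 - W^2)" unfolding y V W using d by algebra
  have n4: "s^8 - p^8 = 2 * y * (V * (V^2 - 2 * W^2))" unfolding y V W using d by algebra
  have n5: "s^10 - p^10 = 2 * y * (V^4 - 3 * V^2 * W^2 + W^4)" unfolding y V W using d by algebra
  define N where "N = W^8 - 1/4 * (V * W^6) + 7/48 * ((V^2 - W^2) * W^4)
    - 31/192 * (V * (V^2 - 2 * W^2) * W^2) + c * (V^4 - 3 * V^2 * W^2 + W^4)"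
  have "asymp_tail c p - asymp_tail c s =
     (1/p^2 - 1/s^2) - 1/4 * (1/p^4 - 1/s^4) + 7/48 * (1/p^6 - 1/s^6)
     - 31/192 * (1/p^8 - 1/s^8) + c * (1/p^10 - 1/s^10)"
    by (simp add: asymp_tail_def ring_distribs)
  also have "\<dots> = 2 * y * (1 / W^2 - 1/4 * (V / W^4) + 7/48 * ((V^2 - W^2) / W^6)
     - 31/192 * (V * (V^2 - 2 * W^2) / W^8) + c * ((V^4 - 3 * V^2 * W^2 + W^4) / W^10))"
    unfolding D n1 n2 n3 n4 n5 by (simp add: ring_distribs)
  also have "1 / W^2 = W^8 / W^10" using \<open>W > 0\<close> by (simp add: field_simps)
  also have "V / W^4 = V * W^6 / W^10" using \<open>W > 0\<close> by (simp add: field_simps)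
  also have "(V^2 - W^2) / W^6 = (V^2 - W^2) * W^4 / W^10" using \<open>W > 0\<close> by (simp add: field_simps)
  also have "V * (V^2 - 2 * W^2) / W^8 = V * (V^2 - 2 * W^2) * W^2 / W^10"
    using \<open>W > 0\<close> by (simp add: field_simps)
  also have "2 * y * (W^8 / W^10 - 1/4 * (V * W^6 / W^10) + 7/48 * ((V^2 - W^2) * W^4 / W^10)
     - 31/192 * (V * (V^2 - 2 * W^2) * W^2 / W^10) + c * ((V^4 - 3 * V^2 * W^2 + W^4) / W^10))
     = 2 * y * (N / W^10)"
  proof -
    have "a1 / w - 1/4 * (a2 / w) + 7/48 * (a3 / w) - 31/192 * (a4 / w) + c * (a5 / w)
        = (a1 - 1/4 * a2 + 7/48 * a3 - 31/192 * a4 + c * a5) / w" for a1 a2 a3 a4 a5 w :: real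
      by (simp add: add_divide_distrib diff_divide_distrib)
    thus ?thesis by (simp add: N_def)
  qed
  finally have "asymp_tail c p - asymp_tail c s - 2 / y^3 = 2 * (y^4 * N - W^10) / (y^3 * W^10)"
    using \<open>W > 0\<close> pos by (simp add: field_simps power3_eq_cube power4_eq_xxxx)
  also have "y^4 * N - W^10 = 1/16 * c + c * W + (101/16 * c - 31/3072) * W^2 + (79/4 * c - 217/1536) * W^3 + (501/16 * c - 1133/1536) * W^4 + (45/2 * c - 437/256) * W^5 + (5 * c - 381/256) * W^6"
  proof -
    have y4: "y^4 = (W + 1/4)^2" by (simp add: W_def)
    show ?thesis unfolding y4 N_def V_def by (simp add: eval_nat_numeral field_simps)
  qed
  finally show ?thesis by (simp add: p_def s_def)
qed

lemma asymp_tail_upper: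
  assumes "y > 1/2"
  shows "2 / y^3 \<le> asymp_tail (3/10) (y - 1/2) - asymp_tail (3/10) (y + 1/2)"
proof -
  have "(1/2)^2 < y^2" using assms by (intro power_strict_mono) auto
  hence "0 \<le> asymp_tail (3/10) (y - 1/2) - asymp_tail (3/10) (y + 1/2) - 2 / y^3"
    using assms by (subst asymp_tail_diff) (auto simp: power2_eq_square)
  thus ?thesis by simp
qed

lemma asymp_tail_lower:
  assumes "y \<ge> 24"
  shows "asymp_tail (29/100) (y - 1/2) - asymp_tail (29/100) (y + 1/2) \<le> 2 / y^3"
proof -
  define W where "W = y^2 - 1/4"
  have "24^2 \<le> y^2" using assms by (intro power_mono) auto
  hence W: "W \<ge> 575" by (simp add: W_def)
  \<comment> \<open>The negative leading term wins: \<open>W\<^sup>6 \<ge> 575 W\<^sup>5\<close>, and all lower powers are at most \<open>W\<^sup>5\<close>.\<close>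
  have "W^k \<le> W^5" if "k \<le> 5" for k
    using W that by (intro power_increasing) auto
  from this[of 0] this[of 1] this[of 2] this[of 3] this[of 4]
  have "1 \<le> W^5" "W \<le> W^5" "W^2 \<le> W^5" "W^3 \<le> W^5" "W^4 \<le> W^5" by simp_all
  moreover have "575 * W^5 \<le> W * W^5" using W by (intro mult_right_mono) auto
  hence "575 * W^5 \<le> W^6" by (simp add: eval_nat_numeral)
  ultimately have neg: "2 * (1/16 * (29/100) + (29/100) * W + (101/16 * (29/100) - 31/3072) * W^2 + (79/4 * (29/100) - 217/1536) * W^3 + (501/16 * (29/100) - 1133/1536) * W^4 + (45/2 * (29/100) - 437/256) * W^5 + (5 * (29/100) - 381/256) * W^6) \<le> 0" by simp
  have "asymp_tail (29/100) (y - 1/2) - asymp_tail (29/100) (y + 1/2) - 2 / y^3 \<le> 0"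
    using neg W assms
    by (subst asymp_tail_diff) (auto simp flip: W_def intro!: divide_nonpos_nonneg)
  thus ?thesis by simp
qed

lemma minus_Polygamma_2_1_tail_bounds:
  shows "- Polygamma 2 (1::real) \<le> (\<Sum>k<23. 2 / (1 + real k)^3) + asymp_tail (3/10) (47/2)"
    and "- Polygamma 2 (1::real) \<ge> (\<Sum>k<23. 2 / (1 + real k)^3) + asymp_tail (29/100) (47/2)"
proof -
  have tail: "(\<lambda>n. 2 / (24 + real n)^3) sums (- Polygamma 2 1 - (\<Sum>k<23. 2 / (1 + real k)^3))"
    using sums_split_initial_segment[OF Polygamma_2_sums[of 1], of 23] by (simp add: add_ac)
  have lim: "(\<lambda>n. asymp_tail c (47/2 + real n)) \<longlonglongrightarrow> 0" for c
    unfolding asymp_tail_def by real_asymp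
  have step: "24 + real n - 1/2 = 47/2 + real n" "24 + real n + 1/2 = 47/2 + real (Suc n)" for n
    by simp_all
  show "- Polygamma 2 (1::real) \<le> (\<Sum>k<23. 2 / (1 + real k)^3) + asymp_tail (3/10) (47/2)"
    using sums_le_telescope[OF tail lim[of "3/10"]] asymp_tail_upper[of "24 + real n" for n]
    unfolding step by simp
  show "- Polygamma 2 (1::real) \<ge> (\<Sum>k<23. 2 / (1 + real k)^3) + asymp_tail (29/100) (47/2)"
    using telescope_le_sums[OF tail lim[of "29/100"]] asymp_tail_lower[of "24 + real n" for n]
    unfolding step by simp
qed

text \<open>
  The two parameters lie \<open>10^-16\<close> below and above \<open>0.4321803644583305\<close>.  Near them
  \<open>neg_Lxx a 0\<close> has slope about \<open>-2\<close> in \<open>a\<close>, and the root lies about half way between the lower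
  parameter and the midpoint, so \<open>-\<psi>''(1)\<close> must be known to within \<open>10^-16\<close>;
  splitting off 23 terms achieves this.
\<close>

lemma minus_Polygamma_2_1_between:
  shows "- Polygamma 2 (1::real) < neg_Lxx (4321803644583304/10^16) 0"
    and "neg_Lxx (4321803644583306/10^16) 0 < - Polygamma 2 (1::real)"
proof -
  have "(\<Sum>k<23. 2 / (1 + real k)^3) + asymp_tail (3/10) (47/2) < neg_Lxx (4321803644583304/10^16) 0"
    by (simp add: asymp_tail_def neg_Lxx_def lessThan_nat_numeral eval_nat_numeral)
  with minus_Polygamma_2_1_tail_bounds(1)
  show "- Polygamma 2 (1::real) < neg_Lxx (4321803644583304/10^16) 0" by linarith
  have "neg_Lxx (4321803644583306/10^16) 0 < (\<Sum>k<23. 2 / (1 + real k)^3) + asymp_tail (29/100) (47/2)"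
    by (simp add: asymp_tail_def neg_Lxx_def lessThan_nat_numeral eval_nat_numeral)
  with minus_Polygamma_2_1_tail_bounds(2)
  show "neg_Lxx (4321803644583306/10^16) 0 < - Polygamma 2 (1::real)" by linarith
qed

section \<open>Nonnegativity away from zero\<close>

lemma two_point_step:
  fixes y \<alpha> :: real
  defines "m \<equiv> y^2 + 1/4 + \<alpha>"
  assumes "\<alpha> > 0"
  shows "((y - 1/2)^2 - \<alpha>) / ((y - 1/2)^2 + \<alpha>)^2 - ((y + 1/2)^2 - \<alpha>) / ((y + 1/2)^2 + \<alpha>)^2
    = 2 * y * ((m^2 - y^2 - 4 * \<alpha> * m) / (m^2 - y^2)^2)"
proof -
  define P where "P = (y - 1/2)^2 + \<alpha>"
  define S where "S = (y + 1/2)^2 + \<alpha>"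
  have pos: "P > 0" "S > 0" using assms by (auto simp: P_def S_def add_nonneg_pos)
  have S: "S = P + 2 * y" and m: "m = P + y"
    by (simp_all add: P_def S_def m_def power2_eq_square algebra_simps)
  have PS: "m^2 - y^2 = P * S" unfolding S m by (simp add: power2_eq_square algebra_simps)
  have *: "(P - 2 * \<alpha>) * S^2 - (S - 2 * \<alpha>) * P^2 = 2 * y * (P * S - 4 * \<alpha> * m)"
    unfolding S m by algebra
  have "(P - 2 * \<alpha>) / P^2 - (S - 2 * \<alpha>) / S^2
      = ((P - 2 * \<alpha>) * S^2 - (S - 2 * \<alpha>) * P^2) / (P * S)^2"
    using pos by (simp add: field_simps)
  thus ?thesis unfolding PS * by (simp add: P_def S_def)
qed

text \<open>
  The parameter \<open>4/9\<close> is slightly larger than the root \<open>a0\<close> and has the convenient partner \<open>b = 1/20\<close>.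
  It must not be much larger, since the step inequality below is to hold from \<open>y = 21/20\<close> on
  and fails at \<open>y = 1\<close> already for \<open>a0\<close>.
\<close>

lemma neg_Lxx_four_ninths:
  "neg_Lxx (4/9) (s^2 - 1/4) =
     9/89 * ((s^2 - 19/36) / (s^2 + 19/36)^2) + 80/89 * ((s^2 - 1/30) / (s^2 + 1/30)^2)"
proof -
  have eq: "s^2 - 1/4 + 1/6 - 4/9 = s^2 - 19/36" "s^2 - 1/4 + 1/3 + 4/9 = s^2 + 19/36"
    "s^2 - 1/4 + 1/6 + 1/20 = s^2 - 1/30" "s^2 - 1/4 + 1/3 - 1/20 = s^2 + 1/30" by simp_all
  have wt: "(1/20 * X + 4/9 * X') / (4/9 + 1/20) = 9/89 * X + 80/89 * X'" for X X' :: real by simp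
  show ?thesis
    using neg_Lxx_two_point[of "4/9" "1/20" "s^2 - 1/4"] unfolding wt eq by simp
qed

lemma neg_Lxx_four_ninths_step:
  fixes y :: real
  assumes "y \<ge> 21/20"
  shows "2 / y^3 \<le> neg_Lxx (4/9) ((y - 1/2)^2 - 1/4) - neg_Lxx (4/9) ((y + 1/2)^2 - 1/4)"
proof -
  define Y where "Y = y^2"
  have "(21/20)^2 \<le> y^2" using assms by (intro power_mono) auto
  hence "Y \<ge> 11/10" by (simp add: Y_def power2_eq_square)
  then obtain t where t: "t \<ge> 0" "Y = t + 11/10" by (metis add_diff_cancel_right' diff_add_cancel diff_ge_0_iff_ge)
  \<comment> \<open>Both sides are \<open>2y\<close> times a rational function of \<open>Y\<close>; the shift by \<open>11/10 \<le> (21/20)\<^sup>2\<close> makes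
    the cleared difference a polynomial in \<open>t\<close> with positive coefficients.\<close>
  define m1 where "m1 = Y + 7/9"
  define m2 where "m2 = Y + 17/60"
  define D1 where "D1 = m1^2 - Y"
  define D2 where "D2 = m2^2 - Y"
  have "Y * 1 \<le> Y * Y" using t by (intro mult_left_mono) auto
  hence D: "D1 > 0" "D2 > 0"
    using t(1) by (auto simp: D1_def D2_def m1_def m2_def power2_eq_square algebra_simps t(2))
  have pos: "(9/89 * (D1 - 19/9 * m1) * D2^2 + 80/89 * (D2 - 2/15 * m2) * D1^2) * Y^2 - D1^2 * D2^2
    = (294406494181 + 18799701331980 * t + 61421369760900 * t^2 + 77270225724000 * t^3
       + 44031979080000 * t^4 + 9720777600000 * t^5) / 42515280000000"
    unfolding D1_def D2_def m1_def m2_def t(2)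
    by (simp add: eval_nat_numeral field_simps)
  have "2 * y * (1 / Y^2) \<le> 2 * y * (9/89 * ((D1 - 19/9 * m1) / D1^2) + 80/89 * ((D2 - 2/15 * m2) / D2^2))"
  proof (rule mult_left_mono)
    have "9/89 * ((D1 - 19/9 * m1) / D1^2) + 80/89 * ((D2 - 2/15 * m2) / D2^2) - 1 / Y^2
      = ((9/89 * (D1 - 19/9 * m1) * D2^2 + 80/89 * (D2 - 2/15 * m2) * D1^2) * Y^2 - D1^2 * D2^2)
        / (D1^2 * D2^2 * Y^2)"
    proof -
      have "c1 * (n1 / d1) + c2 * (n2 / d2) - 1 / w = ((c1 * n1 * d2 + c2 * n2 * d1) * w - d1 * d2) / (d1 * d2 * w)"
        if "d1 > 0" "d2 > 0" "w > 0" for c1 c2 n1 n2 d1 d2 w :: real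
        using that by (simp add: field_simps)
      moreover have "D1^2 > 0" "D2^2 > 0" "Y^2 > 0" using D t by simp_all
      ultimately show ?thesis by blast
    qed
    also have "\<dots> \<ge> 0" unfolding pos using t(1) by simp
    finally show "1 / Y^2 \<le> 9/89 * ((D1 - 19/9 * m1) / D1^2) + 80/89 * ((D2 - 2/15 * m2) / D2^2)"
      by simp
  qed (use assms in auto)
  also have "2 * y * (1 / Y^2) = 2 / y^3"
    using assms by (simp add: Y_def field_simps eval_nat_numeral)
  also have "2 * y * (9/89 * ((D1 - 19/9 * m1) / D1^2) + 80/89 * ((D2 - 2/15 * m2) / D2^2))
     = neg_Lxx (4/9) ((y - 1/2)^2 - 1/4) - neg_Lxx (4/9) ((y + 1/2)^2 - 1/4)"
    using two_point_step[of "19/36" y] two_point_step[of "1/30" y]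
    by (simp add: neg_Lxx_four_ninths D1_def D2_def m1_def m2_def Y_def algebra_simps)
  finally show ?thesis .
qed

lemma Polygamma_2_plus_neg_Lxx_nonneg_far:
  assumes "x \<ge> 1/20"
  shows "0 \<le> Polygamma 2 (x + 1) + neg_Lxx (4/9) (x^2 + x)"
proof -
  define Q where "Q = (\<lambda>n. neg_Lxx (4/9) ((x + real n)^2 + (x + real n)))"
  have "- Polygamma 2 (x + 1) \<le> Q 0"
  proof (rule sums_le_telescope[OF Polygamma_2_sums])
    show "Q \<longlonglongrightarrow> 0" unfolding Q_def neg_Lxx_def by real_asymp
    show "2 / (x + 1 + real n)^3 \<le> Q n - Q (Suc n)" for n
    proof -
      have "((x + 1 + real n) - 1/2)^2 - 1/4 = (x + real n)^2 + (x + real n)"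
        "((x + 1 + real n) + 1/2)^2 - 1/4 = (x + real (Suc n))^2 + (x + real (Suc n))"
        by (simp_all add: power2_eq_square algebra_simps)
      thus ?thesis using neg_Lxx_four_ninths_step[of "x + 1 + real n"] assms by (simp add: Q_def)
    qed
  qed (use assms in auto)
  thus ?thesis by (simp add: Q_def)
qed

section \<open>Monotonicity near zero\<close>

lemma has_field_derivative_neg_Lxx:
  fixes a b x :: real
  defines "u \<equiv> x^2 + x"
  assumes "a > 1/15" "a * b = 1/45" "x \<ge> 0"
  shows "((\<lambda>x. neg_Lxx a (x^2 + x)) has_field_derivative
    (2 * x + 1) * (b * ((3 * a - u) / (u + 1/3 + a)^3) - a * ((u + 3 * b) / (u + 1/3 - b)^3)) / (a + b)) (at x)"
proof -
  have ab: "a > 0" "b > 0" "b < 1/3"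
  proof -
    show "a > 0" using assms by simp
    thus "b > 0" using assms(3) by (metis zero_less_divide_1_iff zero_less_mult_pos zero_less_numeral)
    have b: "b = 1 / (45 * a)" using assms(2,3) by (simp add: field_simps)
    show "b < 1/3" unfolding b using assms(2) by (simp add: field_simps)
  qed
  have *: "((\<lambda>x. (x^2 + x + c) / (x^2 + x + d)^2) has_field_derivative
      (2 * x + 1) * ((d - 2 * c - u) / (u + d)^3)) (at x)" if "d > 0" for c d
  proof -
    have p: "u + d > 0" using that assms by (simp add: u_def add_nonneg_pos)
    have "((\<lambda>x. (x^2 + x + c) / (x^2 + x + d)^2) has_field_derivative
      ((2 * x + 1) * (u + d)^2 - (u + c) * (2 * (u + d) * (2 * x + 1))) / ((u + d)^2 * (u + d)^2)) (at x)"
      using p unfolding u_def by (auto intro!: derivative_eq_intros)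
    also have "((2 * x + 1) * (u + d)^2 - (u + c) * (2 * (u + d) * (2 * x + 1)))
      = (u + d) * ((2 * x + 1) * (d - 2 * c - u))" by (simp add: power2_eq_square algebra_simps)
    also have "(u + d) * ((2 * x + 1) * (d - 2 * c - u)) / ((u + d)^2 * (u + d)^2)
      = (2 * x + 1) * ((d - 2 * c - u) / (u + d)^3)"
      using p by (simp add: eval_nat_numeral)
    finally show ?thesis .
  qed
  have eq: "(\<lambda>x. neg_Lxx a (x^2 + x)) = (\<lambda>x. (b * ((x^2 + x + (1/6 - a)) / (x^2 + x + (1/3 + a))^2)
      + a * ((x^2 + x + (1/6 + b)) / (x^2 + x + (1/3 - b))^2)) / (a + b))"
    by (rule ext, subst neg_Lxx_two_point[OF ab(1) assms(3)]) (simp add: algebra_simps)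
  have "((\<lambda>x. neg_Lxx a (x^2 + x)) has_field_derivative
      (b * ((2 * x + 1) * ((1/3 + a - 2 * (1/6 - a) - u) / (u + (1/3 + a))^3))
        + a * ((2 * x + 1) * ((1/3 - b - 2 * (1/6 + b) - u) / (u + (1/3 - b))^3))) / (a + b)) (at x)"
    unfolding eq by (intro DERIV_cdivide DERIV_add DERIV_cmult *) (use ab in auto)
  also have "1/3 + a - 2 * (1/6 - a) - u = 3 * a - u" by simp
  also have "1/3 - b - 2 * (1/6 + b) - u = - (u + 3 * b)" by simp
  also have "(b * ((2 * x + 1) * (X / P)) + a * ((2 * x + 1) * (- Z / R))) / (a + b)
      = (2 * x + 1) * (b * (X / P) - a * (Z / R)) / (a + b)" for X P Z R
    by (simp add: right_diff_distrib mult.left_commute)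
  finally show ?thesis by (simp only: add_diff_eq add.assoc)
qed

text \<open>
  On \<open>[0, 1/20]\<close> the positive term \<open>\<psi>'''(x + 1)\<close> falls from about \<open>6.5\<close> to \<open>5.4\<close>, while the
  node \<open>-b\<close> contributes a negative term rising from about \<open>-6.2\<close> to \<open>-5.4\<close> and the node \<open>a\<close> a
  positive one between \<open>0.2\<close> and \<open>0.4\<close>.  No constant separates the size of the negative term from
  the sum of the positive ones, but the line \<open>6.58 - 20.5 x\<close> does.  The parameter enters only
  through crude bounds, for which the interval \<open>[0.432, 0.433]\<close> is narrow enough.
\<close>

lemma Polygamma_2_plus_neg_Lxx_deriv_pos_near:
  fixes a b x :: real
  assumes a: "432/1000 \<le> a" "a \<le> 433/1000" and ab: "a * b = 1/45" and x: "0 \<le> x" "x \<le> 1/20"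
  defines "u \<equiv> x^2 + x"
  shows "Polygamma 3 (x + 1) + (2 * x + 1) *
    (b * ((3 * a - u) / (u + 1/3 + a)^3) - a * ((u + 3 * b) / (u + 1/3 - b)^3)) / (a + b) > 0"
proof -
  have b: "b = 1 / (45 * a)" using a ab by (simp add: field_simps)
  have b1: "b > 0" "b \<le> 13/250" unfolding b using a by (auto simp: field_simps)
  have "a^2 \<le> (433/1000)^2" "(432/1000)^2 \<le> a^2" using a by (auto intro!: power_mono)
  hence w: "b / (a + b) \<ge> 21/200" "a / (a + b) \<le> 9/10"
    unfolding b using a by (auto simp: field_simps power2_eq_square)
  have "x^2 \<le> (1/20)^2" using x by (intro power_mono) auto
  hence u: "0 \<le> u" "u \<le> 21/400" using x by (auto simp: u_def power2_eq_square)

  have "47/200 \<le> 21/200 * ((12435/10000) / (8189/10000)^3 :: real)" by (simp add: eval_nat_numeral)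
  also have "\<dots> \<le> b / (a + b) * ((3 * a - u) / (u + 1/3 + a)^3)"
    using w a u b1 by (intro mult_mono[OF w(1) frac_le] power_mono) auto
  finally have 1: "47/200 \<le> b / (a + b) * ((3 * a - u) / (u + 1/3 + a)^3)" .

  have 2: "a / (a + b) * ((u + 3 * b) / (u + 1/3 - b)^3) \<le> 9/10 * ((u + 39/250) / (u + 211/750)^3)"
    using w a u b1 by (intro mult_mono[OF w(2) frac_le] power_mono) auto

  have 3: "6 / (x + 1)^4 + 2/5 \<le> Polygamma 3 (x + 1)"
  proof -
    have S: "(\<lambda>n. 6 / (x + 1 + real n)^4) sums Polygamma 3 (x + 1)"
      using x by (intro Polygamma_3_sums) auto
    have "(\<Sum>n<3. 6 / (x + 1 + real n)^4) \<le> (\<Sum>n. 6 / (x + 1 + real n)^4)"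
      using S x by (intro sum_le_suminf) (auto simp: sums_iff)
    also have "\<dots> = Polygamma 3 (x + 1)" using S by (simp add: sums_iff)
    finally have "6 / (x + 1)^4 + (6 / (x + 2)^4 + 6 / (x + 3)^4) \<le> Polygamma 3 (x + 1)"
      by (simp add: eval_nat_numeral add_ac)
    moreover have "6 / (41/20)^4 \<le> 6 / (x + 2)^4" "6 / (61/20)^4 \<le> 6 / (x + 3)^4"
      using x by (auto intro!: divide_left_mono power_mono)
    ultimately show ?thesis by (simp add: power_divide)
  qed

  have 4: "5945/1000 - 2097/100 * x \<le> 6 / (x + 1)^4"
  proof -
    \<comment> \<open>The line is parallel to the tangent of \<open>6/(x+1)\<^sup>4\<close> near \<open>x = 0.027\<close> and lies just below it.\<close>
    have "0 \<le> 6 - (5945/1000 - 2097/100 * x) * (x + 1)^4"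
    proof -
      have "6 - (5945/1000 - 2097/100 * x) * (x + 1)^4 =
         (55/1000 - 281/100 * x + 4821/100 * x^2) + x^3 * (10204/100 + 77935/1000 * x + 2097/100 * x^2)"
        by (simp add: eval_nat_numeral field_simps)
      also have "55/1000 - 281/100 * x + 4821/100 * x^2 = 4821/100 * (x - 281/9642)^2 + (55/1000 - 4821/100 * (281/9642)^2)"
        by (simp add: power2_eq_square field_simps)
      also have "\<dots> + x^3 * (10204/100 + 77935/1000 * x + 2097/100 * x^2) \<ge> 0"
        using x by (intro add_nonneg_nonneg mult_nonneg_nonneg) (auto simp: power2_eq_square)
      finally show ?thesis .
    qed
    thus ?thesis using x by (simp add: field_simps)
  qed

  have 5: "(2 * x + 1) * (9/10 * ((u + 39/250) / (u + 211/750)^3)) < 658/100 - 205/10 * x"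
  proof -
    \<comment> \<open>All nonconstant coefficients are negative, so the minimum is at \<open>x = 1/20\<close>.\<close>
    have "(658/100 - 205/10 * x) * (u + 211/750)^3 - 9/10 * ((2 * x + 1) * (u + 39/250))
      = 129040799/21093750000 - 63184361/843750000 * x - 705811/1562500 * x^2 - 2355971/375000 * x^3
        - 372631/12500 * x^4 - 29531/500 * x^5 - 1373/25 * x^6 - 41/2 * x^7"
      unfolding u_def by (simp add: eval_nat_numeral field_simps)
    moreover have "x^k \<le> (1/20)^k" for k using x by (intro power_mono) auto
    from this[of 2] this[of 3] this[of 4] this[of 5] this[of 6] this[of 7]
    have "0 < 129040799/21093750000 - 63184361/843750000 * x - 705811/1562500 * x^2 - 2355971/375000 * x^3
        - 372631/12500 * x^4 - 29531/500 * x^5 - 1373/25 * x^6 - 41/2 * x^7"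
      using x by (simp add: power_divide)
    ultimately have "9/10 * ((2 * x + 1) * (u + 39/250)) < (658/100 - 205/10 * x) * (u + 211/750)^3"
      by linarith
    thus ?thesis using u by (simp add: field_simps)
  qed

  have "(2 * x + 1) * (b * X - a * Z) / (a + b) = (2 * x + 1) * (b / (a + b) * X - a / (a + b) * Z)" for X Z
    by (simp add: diff_divide_distrib flip: times_divide_eq_right)
  also have "(2 * x + 1) * (b / (a + b) * ((3 * a - u) / (u + 1/3 + a)^3)
        - a / (a + b) * ((u + 3 * b) / (u + 1/3 - b)^3))
      \<ge> (2 * x + 1) * (47/200 - 9/10 * ((u + 39/250) / (u + 211/750)^3))"
    by (intro mult_left_mono diff_mono 1 2) (use x in auto)
  finally have 6: "(2 * x + 1) * (47/200) - (2 * x + 1) * (9/10 * ((u + 39/250) / (u + 211/750)^3))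
      \<le> (2 * x + 1) * (b * ((3 * a - u) / (u + 1/3 + a)^3) - a * ((u + 3 * b) / (u + 1/3 - b)^3)) / (a + b)"
    by (simp only: right_diff_distrib)
  have "0 < P + D" if "E + 2/5 \<le> P" "5945/1000 - 2097/100 * x \<le> E" "G < 658/100 - 205/10 * x"
    "(2 * x + 1) * (47/200) - G \<le> D" for P D E G
    using that by (simp add: algebra_simps)
  from this[OF 3 4 5 6] show ?thesis .
qed

section \<open>Convexity and the second derivative\<close>

lemma convex_on_imp_second_deriv_nonneg:
  fixes f :: "real \<Rightarrow> real"
  assumes "convex_on S f" "open S" "connected S"
    and f': "\<And>x. x \<in> S \<Longrightarrow> (f has_field_derivative f' x) (at x)"
    and f'': "(f' has_field_derivative f'') (at x)" and "x \<in> S"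
  shows "f'' \<ge> 0"
proof (rule ccontr)
  assume "\<not> f'' \<ge> 0"
  then obtain d where d: "d > 0" "\<And>h. 0 < h \<Longrightarrow> h < d \<Longrightarrow> f' x > f' (x + h)"
    using DERIV_neg_dec_right[OF f''] by auto
  obtain e where e: "e > 0" "ball x e \<subseteq> S" using assms by (meson openE)
  define h where "h = min d e / 2"
  have h: "0 < h" "h < d" "h < e" using d e by (auto simp: h_def)
  hence S: "x + h \<in> S" using e by (auto simp: dist_norm)
  have tangent: "f' c * (y - c) \<le> f y - f c" if "c \<in> S" "y \<in> S" for c y
    using convex_on_imp_above_tangent[OF assms(1,3) _ that(2), of c "f' c"] that assms(2)
      has_field_derivative_at_within[OF f'[OF that(1)]] by (simp add: interior_open)
  from tangent[OF \<open>x \<in> S\<close> S] tangent[OF S \<open>x \<in> S\<close>] have "f' x * h \<le> f' (x + h) * h" by simp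
  hence "f' x \<le> f' (x + h)" using h by simp
  with d(2)[of h] h show False by simp
qed

definition F' :: "real \<Rightarrow> real \<Rightarrow> real" where
  "F' a x = Polygamma 1 (x + 1)
     - (1 / (90 * a^2 + 2) * ((2 * x + 1) / (x^2 + x + (3 * a + 1) / 3))
      + 45 * a^2 / (90 * a^2 + 2) * ((2 * x + 1) / (x^2 + x + (15 * a - 1) / (45 * a))))"

lemma Polygamma_plus_1_has_field_derivative:
  fixes x :: real
  assumes "x > -1"
  shows "((\<lambda>x. Polygamma n (x + 1)) has_field_derivative Polygamma (Suc n) (x + 1)) (at x)"
proof -
  have "x + 1 \<notin> \<int>\<^sub>\<le>\<^sub>0" using assms nonpos_Ints_nonpos by fastforce
  moreover have "((\<lambda>x. x + 1) has_field_derivative 1) (at x)" by (auto intro!: derivative_eq_intros)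
  ultimately show ?thesis
    using DERIV_chain2[where f = "Polygamma n" and g = "\<lambda>x. x + 1"] has_field_derivative_Polygamma
    by fastforce
qed

lemma F_derivatives:
  assumes "a > 1/15" "x > 0"
  shows "(F a has_field_derivative F' a x) (at x)"
    and "(F' a has_field_derivative Polygamma 2 (x + 1) + neg_Lxx a (x^2 + x)) (at x)"
proof -
  define p where "p = (3 * a + 1) / 3"
  define q where "q = (15 * a - 1) / (45 * a)"
  have pq: "p > 0" "q > 0" using assms by (auto simp: p_def q_def)
  hence pos: "x^2 + x + p > 0" "x^2 + x + q > 0" using assms by (auto simp: add_pos_pos)
  have ln: "((\<lambda>x. ln (x^2 + x + c)) has_field_derivative (2 * x + 1) / (x^2 + x + c)) (at x)"
    if "x^2 + x + c > 0" for c
    using that by (auto intro!: derivative_eq_intros)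
  have frac: "((\<lambda>x. (2 * x + 1) / (x^2 + x + c)) has_field_derivative
      - 2 * ((x^2 + x - c + 1/2) / (x^2 + x + c)^2)) (at x)"
    if "x^2 + x + c > 0" for c
    using that by (auto intro!: derivative_eq_intros simp: power2_eq_square algebra_simps)
  show "(F a has_field_derivative F' a x) (at x)"
    unfolding F_def[abs_def] L_def F'_def p_def[symmetric] q_def[symmetric]
    using Polygamma_plus_1_has_field_derivative[of x 0] assms by (intro DERIV_diff DERIV_add DERIV_cmult ln pos) auto
  have "((F' a) has_field_derivative Polygamma 2 (x + 1)
     - (1 / (90 * a^2 + 2) * (- 2 * ((x^2 + x - p + 1/2) / (x^2 + x + p)^2))
      + 45 * a^2 / (90 * a^2 + 2) * (- 2 * ((x^2 + x - q + 1/2) / (x^2 + x + q)^2)))) (at x)"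
    unfolding F'_def[abs_def] p_def[symmetric] q_def[symmetric]
    using Polygamma_plus_1_has_field_derivative[of x 1] assms by (intro DERIV_diff DERIV_add DERIV_cmult frac pos) (auto simp: numeral_2_eq_2)
  also have "x^2 + x - p + 1/2 = x^2 + x - a + 1/6" by (simp add: p_def field_simps)
  also have "x^2 + x - q + 1/2 = x^2 + x + 1 / (45 * a) + 1/6"
    using assms by (simp add: q_def field_simps)
  also have "x^2 + x + p = x^2 + x + a + 1/3" by (simp add: p_def field_simps)
  also have "1 / (90 * a^2 + 2) = 1 / (45 * a^2 + 1) / 2" by (simp add: field_simps)
  also have "45 * a^2 / (90 * a^2 + 2) = 45 * a^2 / (45 * a^2 + 1) / 2" by simp
  also have "Polygamma 2 (x + 1) - (K / 2 * (- 2 * X) + K' / 2 * (- 2 * X')) = Polygamma 2 (x + 1) + (K * X + K' * X')"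
    for K K' X X' by simp
  finally show "(F' a has_field_derivative Polygamma 2 (x + 1) + neg_Lxx a (x^2 + x)) (at x)"
    unfolding neg_Lxx_def q_def .
qed

section \<open>The critical parameter\<close>

lemma deriv2_Digamma_1: "(deriv ^^ 2) Digamma (1::real) = Polygamma 2 1"
proof -
  have D: "deriv (Polygamma n) x = Polygamma (Suc n) x" if "x > 0" for n and x :: real
    using that nonpos_Ints_nonpos[of x] by (intro DERIV_imp_deriv has_field_derivative_Polygamma) force
  have "\<forall>\<^sub>F x in nhds (1::real). x \<in> {0<..}" by (rule eventually_nhds_in_open) auto
  hence "\<forall>\<^sub>F x in nhds (1::real). deriv Digamma x = Polygamma 1 x"
    by eventually_elim (simp add: D)
  hence "deriv (deriv Digamma) (1::real) = deriv (Polygamma 1) 1" by (rule deriv_cong_ev) simp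
  also have "\<dots> = Polygamma 2 1" by (simp add: D numeral_2_eq_2)
  finally show ?thesis by (simp add: numeral_2_eq_2)
qed

lemma continuous_on_neg_Lxx_0: "continuous_on {1/15<..} (\<lambda>a. neg_Lxx a 0)"
  unfolding neg_Lxx_def
  by (intro continuous_intros) (auto simp: add_nonneg_eq_0_iff intro: add_nonneg_pos less_imp_neq[symmetric])

lemma Polygamma_2_plus_neg_Lxx_0_root:
  obtains a0 :: real where "4321803644583304/10^16 < a0" "a0 < 4321803644583306/10^16"
    "Polygamma 2 1 + neg_Lxx a0 0 = 0"
proof -
  let ?l = "4321803644583304/10^16 :: real" and ?h = "4321803644583306/10^16 :: real"
  have "\<exists>a\<ge>?l. a \<le> ?h \<and> neg_Lxx a 0 = - Polygamma 2 1"
  proof (rule IVT2')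
    show "continuous_on {?l..?h} (\<lambda>a. neg_Lxx a 0)"
      by (rule continuous_on_subset[OF continuous_on_neg_Lxx_0]) auto
  qed (use minus_Polygamma_2_1_between in auto)
  then obtain a where a: "?l \<le> a" "a \<le> ?h" "neg_Lxx a 0 = - Polygamma 2 1" by blast
  moreover have "a \<noteq> ?l" "a \<noteq> ?h" using minus_Polygamma_2_1_between a(3) by (metis less_irrefl)+
  ultimately show ?thesis by (intro that[of a]) auto
qed

lemma Polygamma_2_plus_neg_Lxx_pos:
  assumes a0: "4321803644583304/10^16 < a0" "a0 < 4321803644583306/10^16"
    and root: "Polygamma 2 1 + neg_Lxx a0 0 = 0" and "x > 0"
  shows "Polygamma 2 (x + 1) + neg_Lxx a0 (x^2 + x) > 0"
proof (cases "x \<le> 1/20")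
  case True
  define b where "b = 1 / (45 * a0)"
  have ab: "a0 * b = 1/45" using a0 by (simp add: b_def)
  let ?f = "\<lambda>x. Polygamma 2 (x + 1) + neg_Lxx a0 (x^2 + x)"
  have "?f 0 < ?f x"
  proof (rule DERIV_pos_imp_increasing[OF \<open>x > 0\<close>])
    fix z assume z: "0 \<le> z" "z \<le> x"
    let ?D = "(2 * z + 1) * (b * ((3 * a0 - (z^2 + z)) / ((z^2 + z) + 1/3 + a0)^3)
          - a0 * (((z^2 + z) + 3 * b) / ((z^2 + z) + 1/3 - b)^3)) / (a0 + b)"
    have "(?f has_field_derivative Polygamma 3 (z + 1) + ?D) (at z)"
      using Polygamma_plus_1_has_field_derivative[of z 2]
        has_field_derivative_neg_Lxx[OF _ ab z(1)] z a0
      by (intro DERIV_add) (simp_all add: numeral_3_eq_3 numeral_2_eq_2)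
    moreover have "Polygamma 3 (z + 1) + ?D > 0"
      using Polygamma_2_plus_neg_Lxx_deriv_pos_near[OF _ _ ab z(1)] z True a0 by simp
    ultimately show "\<exists>y. (?f has_field_derivative y) (at z) \<and> y > 0" by blast
  qed
  thus ?thesis using root by simp
next
  case False
  have "0 \<le> Polygamma 2 (x + 1) + neg_Lxx (4/9) (x^2 + x)"
    using False by (intro Polygamma_2_plus_neg_Lxx_nonneg_far) auto
  also have "\<dots> < Polygamma 2 (x + 1) + neg_Lxx a0 (x^2 + x)"
    using a0 False by (intro add_strict_left_mono neg_Lxx_strict_antimono) auto
  finally show ?thesis .
qed

section \<open>Characterisation of convexity\<close>

theorem theorem3:
  shows "\<exists>a0::real. a0 > 1/15
      \<and> (deriv ^^ 2) Digamma 1 - Lxx 0 a0 = 0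
      \<and> (\<forall>b>1/15. (deriv ^^ 2) Digamma 1 - Lxx 0 b = 0 \<longrightarrow> b = a0)
      \<and> \<bar>a0 - 0.4321803644583305\<bar> < 1 / 10 ^ 16
      \<and> (\<forall>a>1/15. convex_on {0<..} (F a) \<longleftrightarrow> a \<in> {1/15<..a0})"
proof -
  obtain a0 :: real where a0: "4321803644583304/10^16 < a0" "a0 < 4321803644583306/10^16"
    and root: "Polygamma 2 1 + neg_Lxx a0 0 = 0"
    by (rule Polygamma_2_plus_neg_Lxx_0_root)
  have a15: "a0 > 1/15" using a0 by simp
  have eq: "(deriv ^^ 2) Digamma 1 - Lxx 0 a = Polygamma 2 1 + neg_Lxx a 0" if "a > 1/15" for a
    using Lxx_eq[of 0 a] that by (simp add: deriv2_Digamma_1)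
  have uniq: "b = a0" if "b > 1/15" "Polygamma 2 1 + neg_Lxx b 0 = 0" for b
    using neg_Lxx_strict_antimono[of b a0 0] neg_Lxx_strict_antimono[of a0 b 0] that a15 root
    by (cases b a0 rule: linorder_cases) auto
  have convex: "convex_on {0<..} (F a)" if a: "a > 1/15" "a \<le> a0" for a
  proof (rule f''_ge0_imp_convex)
    fix x :: real assume "x \<in> {0<..}"
    hence x: "x > 0" by simp
    show "(F a has_field_derivative F' a x) (at x)"
      "(F' a has_field_derivative Polygamma 2 (x + 1) + neg_Lxx a (x^2 + x)) (at x)"
      using F_derivatives[OF a(1) x] by auto
    have "neg_Lxx a0 (x^2 + x) \<le> neg_Lxx a (x^2 + x)"
      using neg_Lxx_strict_antimono[of a a0 "x^2 + x"] a x by (cases "a = a0") auto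
    with Polygamma_2_plus_neg_Lxx_pos[OF a0 root x]
    show "Polygamma 2 (x + 1) + neg_Lxx a (x^2 + x) \<ge> 0" by linarith
  qed auto
  have "a \<le> a0" if a: "a > 1/15" and conv: "convex_on {0<..} (F a)" for a
  proof -
    have nonneg: "Polygamma 2 (x + 1) + neg_Lxx a (x^2 + x) \<ge> 0" if "x > 0" for x
      using convex_on_imp_second_deriv_nonneg[OF conv _ _ F_derivatives(1)[OF a] F_derivatives(2)[OF a]] that
      by simp
    define b where "b = 1 / (45 * a)"
    have ab: "a * b = 1/45" using a by (simp add: b_def)
    have "((\<lambda>x. Polygamma 2 (x + 1) + neg_Lxx a (x^2 + x)) \<longlongrightarrow> Polygamma 2 (0 + 1) + neg_Lxx a (0^2 + 0)) (at 0)"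
      using DERIV_isCont[OF Polygamma_plus_1_has_field_derivative[of 0 2]]
        DERIV_isCont[OF has_field_derivative_neg_Lxx[OF a ab, of 0]]
      by (intro tendsto_add) (simp_all add: isCont_def)
    hence "((\<lambda>x. Polygamma 2 (x + 1) + neg_Lxx a (x^2 + x)) \<longlongrightarrow> Polygamma 2 1 + neg_Lxx a 0) (at_right 0)"
      by (simp add: filterlim_at_split)
    moreover have "\<forall>\<^sub>F x in at_right 0. 0 \<le> Polygamma 2 (x + 1) + neg_Lxx a (x^2 + x)"
      using nonneg by (auto simp: eventually_at_right_field intro: exI[of _ 1])
    ultimately have "0 \<le> Polygamma 2 1 + neg_Lxx a 0"
      by (intro tendsto_lowerbound) auto
    with root neg_Lxx_strict_antimono[of a0 a 0] a15 show ?thesis by force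
  qed
  with convex have iff: "convex_on {0<..} (F a) \<longleftrightarrow> a \<in> {1/15<..a0}" if "a > 1/15" for a
    using that by auto
  have "- (a0 - 0.4321803644583305) < 1 / 10 ^ 16" "a0 - 0.4321803644583305 < 1 / 10 ^ 16"
    using a0 by simp_all
  hence digits: "\<bar>a0 - 0.4321803644583305\<bar> < 1 / 10 ^ 16"
    unfolding abs_less_iff by blast
  show ?thesis
  proof (intro exI[of _ a0] conjI allI impI)
    show "b = a0" if "b > 1/15" "(deriv ^^ 2) Digamma 1 - Lxx 0 b = 0" for b
      using uniq eq that by metis
  qed (fact a15, fact root[folded eq[OF a15]], fact digits, fact iff)
qed

end
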